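(* Let $B(x)=\sum_{n\ge 0} b_n x^n$ and $F(x)=\sum_{n>0} f_n x^n$ be ordinary generating functions with integer coefficients. Let $R(x)=\int B(x)=\sum_{n>0}\frac{b_{n-1}}{n}x^n$, and let $G(x)=\sum_{n>0} g_n x^n$ be the composition $G(x)=R(F(x))$. Then for every $n\in\mathbb{N}$ (positive integers) the value $$n g_n = n\sum_{k=1}^{n}\frac{F^{\Delta}(n,k)\,b_{k-1}}{k}$$ is an integer, where $F^{\Delta}(n,k)$ is the composita of $F(x)$.
   Context: All generating functions are formal power series (with rational coefficients). The integral of a formal power series $B(x)=\sum_{n\ge0} b_nx^n$ is the term-by-term integral with zero constant term, $\int B(x)=\sum_{n>0}\frac{b_{n-1}}{n}x^n$. For $R(x)=\sum_{n\ge 0} r_n x^n$ and $F(x)=\sum_{n>0} f_n x^n$ (zero constant term), the composition is the well-defined formal power series $R(F(x))=\sum_{n\ge 0} r_n F(x)^n$. The composita of $F(x)=\sum_{n>0} f_n x^n$ is the function of two variables $$F^{\Delta}(n,k)=\sum f_{\lambda_1} f_{\lambda_2}\cdots f_{\lambda_k},$$ where the sum runs over all compositions of $n$ into exactly $k$ parts, i.e. all ordered $k$-tuples $(\lambda_1,\dots,\lambda_k)$ of positive integers with $\lambda_1+\cdots+\lambda_k=n$. Equivalently, $F(x)^k=\sum_{n\ge k}F^{\Delta}(n,k)x^n$. *)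

theory Defs
  imports "HOL-Computational_Algebra.Formal_Power_Series"
begin

definition compositions :: "nat \<Rightarrow> nat \<Rightarrow> nat list set" where
  "compositions n k = {ls. length ls = k \<and> (\<forall>l\<in>set ls. 0 < l) \<and> sum_list ls = n}"

(* Needed for the sum in the definition of composita not to be the default value 0. *)
lemma finite_compositions: "finite (compositions n k)"
proof (rule finite_subset)
  show "compositions n k \<subseteq> {ls. set ls \<subseteq> {..n} \<and> length ls = k}"
    by (auto simp: compositions_def dest: member_le_sum_list)
  show "finite {ls. set ls \<subseteq> {..n} \<and> length ls = k}"
    by (rule finite_lists_length_eq) simp
qed

definition composita :: "'a::comm_semiring_1 fps \<Rightarrow> nat \<Rightarrow> nat \<Rightarrow> 'a" where
  "composita F n k = (\<Sum>ls\<in>compositions n k. prod_list (map (fps_nth F) ls))"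

end

theory Submission
  imports Defs
begin

text \<open>
  The integrality comes from differentiating. Since \<open>R' = B\<close>, the chain rule gives
  \<open>G' = (B \<circ> F) \<cdot> F'\<close>, where the denominators brought in by the integral have disappeared:
  derivative, composition and product keep power series with integer coefficients among
  themselves, and \<open>n g\<^sub>n\<close> is the coefficient of \<open>x\<^bsup>n - 1\<^esup>\<close> in \<open>G'\<close>. In the explicit sum this
  is visible term by term: \<open>(F\<^sup>k)' = k F\<^bsup>k - 1\<^esup> F'\<close>, so \<open>k\<close> divides \<open>n\<close> times the composita.

  The explicit sum itself is the definition of composition of series, once the composita is
  recognised as the coefficient of \<open>x\<^sup>n\<close> in \<open>F\<^sup>k\<close> (\<open>fps_power_nth_composita\<close>).
\<close>

text \<open>
  Splitting off the first part turns a composition of \<open>n\<close> into a choice of \<open>l\<close> and a composition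
  of \<open>n - l\<close>, just as the Cauchy product splits off one factor of \<open>F\<^bsup>k + 1\<^esup>\<close>.
\<close>

lemma compositions_Suc:
  "compositions n (Suc k) = (\<lambda>(l, ls). l # ls) ` (SIGMA l:{1..n}. compositions (n - l) k)"
proof (intro equalityI subsetI)
  fix ls assume "ls \<in> compositions n (Suc k)"
  then obtain l ls' where "ls = l # ls'" "l \<in> {1..n}" "ls' \<in> compositions (n - l) k"
    by (cases ls) (auto simp: compositions_def)
  then show "ls \<in> (\<lambda>(l, ls). l # ls) ` (SIGMA l:{1..n}. compositions (n - l) k)"
    by force
qed (auto simp: compositions_def)

lemma composita_0: "composita F n 0 = (if n = 0 then 1 else 0)"
proof -
  have "compositions n 0 = (if n = 0 then {[]} else {})"
    by (auto simp: compositions_def)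
  then show ?thesis
    by (simp add: composita_def)
qed

lemma composita_Suc:
  "composita F n (Suc k) = (\<Sum>l=1..n. fps_nth F l * composita F (n - l) k)"
proof -
  have "inj_on (\<lambda>(l, ls). l # ls) (SIGMA l:{1..n}. compositions (n - l) k)"
    by (auto simp: inj_on_def)
  then have "composita F n (Suc k)
      = (\<Sum>(l, ls)\<in>(SIGMA l:{1..n}. compositions (n - l) k).
           fps_nth F l * prod_list (map (fps_nth F) ls))"
    by (simp add: composita_def compositions_Suc sum.reindex case_prod_unfold)
  then show ?thesis
    by (simp add: composita_def sum.Sigma finite_compositions sum_distrib_left)
qed

text \<open>
  The parts of a composition are positive, so tuples with a zero part must not contribute to
  the power; this is what the vanishing constant term ensures.
\<close>

lemma fps_power_nth_composita:
  fixes F :: "'a::comm_semiring_1 fps"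
  assumes "fps_nth F 0 = 0"
  shows "fps_nth (F ^ k) n = composita F n k"
proof (induction k arbitrary: n)
  case 0
  show ?case by (simp add: composita_0)
next
  case (Suc k)
  have "fps_nth (F ^ Suc k) n = (\<Sum>l=0..n. fps_nth F l * composita F (n - l) k)"
    by (simp add: fps_mult_nth Suc)
  also have "\<dots> = (\<Sum>l=1..n. fps_nth F l * composita F (n - l) k)"
    using assms by (simp add: sum.atLeast_Suc_atMost)
  finally show ?case by (simp add: composita_Suc)
qed

lemma fps_mult_nth_Ints:
  fixes f g :: "'a::ring_1 fps"
  assumes "\<And>i. fps_nth f i \<in> \<int>" and "\<And>i. fps_nth g i \<in> \<int>"
  shows "fps_nth (f * g) n \<in> \<int>"
  unfolding fps_mult_nth by (intro Ints_sum Ints_mult assms)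

lemma fps_power_nth_Ints:
  fixes f :: "'a::ring_1 fps"
  assumes "\<And>i. fps_nth f i \<in> \<int>"
  shows "fps_nth (f ^ k) n \<in> \<int>"
proof (induction k arbitrary: n)
  case (Suc k)
  then show ?case by (auto intro: fps_mult_nth_Ints assms)
qed simp

lemma fps_compose_nth_Ints:
  fixes f g :: "'a::ring_1 fps"
  assumes "\<And>i. fps_nth f i \<in> \<int>" and "\<And>i. fps_nth g i \<in> \<int>"
  shows "fps_nth (fps_compose f g) n \<in> \<int>"
  unfolding fps_compose_nth by (intro Ints_sum Ints_mult fps_power_nth_Ints assms)

lemma fps_deriv_nth_Ints:
  fixes f :: "'a::ring_1 fps"
  assumes "\<And>i. fps_nth f i \<in> \<int>"
  shows "fps_nth (fps_deriv f) n \<in> \<int>"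
  unfolding fps_deriv_nth by (intro Ints_mult Ints_of_nat assms)

theorem theorem3p2:
  fixes B F R G :: "rat fps" and n :: nat
  assumes B_int: "\<And>i. fps_nth B i \<in> \<int>"
    and F_int: "\<And>i. fps_nth F i \<in> \<int>"
    and F_0: "fps_nth F 0 = 0"
    and R_def: "R = fps_integral0 B"
    and G_def: "G = fps_compose R F"
    and n_pos: "n > 0"
  shows "of_nat n * fps_nth G n
           = of_nat n * (\<Sum>k=1..n. composita F n k * fps_nth B (k - 1) / of_nat k)
         \<and> of_nat n * fps_nth G n \<in> \<int>"

proof
  have "fps_nth G n = (\<Sum>k=0..n. fps_nth R k * composita F n k)"
    by (simp add: G_def fps_compose_nth fps_power_nth_composita[OF F_0])
  also have "\<dots> = (\<Sum>k=1..n. fps_nth R k * composita F n k)"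
    by (simp add: R_def fps_integral_def sum.atLeast_Suc_atMost)
  also have "\<dots> = (\<Sum>k=1..n. composita F n k * fps_nth B (k - 1) / of_nat k)"
    by (intro sum.cong) (auto simp: R_def fps_integral_def field_simps)
  finally show "of_nat n * fps_nth G n
      = of_nat n * (\<Sum>k=1..n. composita F n k * fps_nth B (k - 1) / of_nat k)"
    by simp
next
  have "fps_deriv G = fps_compose B F * fps_deriv F"
    by (simp add: G_def R_def fps_compose_deriv[OF F_0] fps_deriv_fps_integral)
  then have "fps_nth (fps_deriv G) (n - 1) \<in> \<int>"
    by (simp add: fps_mult_nth_Ints fps_compose_nth_Ints fps_deriv_nth_Ints B_int F_int
        del: fps_deriv_nth)
  then show "of_nat n * fps_nth G n \<in> \<int>"
    using n_pos by simp
qed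

end
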